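(* Let $m\ge 1$, $n\ge 0$ and $k\ge 1$ be integers, and let $\nu_{2l}^{m|0}$, $l=1,2,\ldots$, be a sequence of fundamental solutions of the natural powers of $\Delta_b=-\sum_{j=1}^m\partial_{x_j}^2$ on $\mathbb{R}^m$ satisfying $\Delta_b^j\nu_{2l}^{m|0}=\nu_{2l-2j}^{m|0}$ for $j<l$ and $\Delta_b^l\nu_{2l}^{m|0}=\delta(\underline{x})$. Then the function $\nu_{2k}^{m|2n}$ defined by $$\nu_{2k}^{m|2n}=\sum_{l=0}^n4^l\,\frac{(l+k-1)!}{(n-l)!\,(k-1)!}\,\nu_{2l+2k}^{m|0}\,\underline{\grave{x}}^{2n-2l}$$ is a fundamental solution for the operator $\Delta^k$, where $\Delta$ is the super Laplace operator; i.e. $\Delta^k\,\nu_{2k}^{m|2n}=\delta(x)$ in the distributional sense.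
   Context: Variables: $x_1,\ldots,x_m$ are commuting real variables (coordinates on $\mathbb{R}^m$); $\grave{x}_1,\ldots,\grave{x}_{2n}$ are anticommuting variables ($\grave{x}_i\grave{x}_j=-\grave{x}_j\grave{x}_i$) generating the real Grassmann algebra $\Lambda_{2n}$; the $x_i$ commute with the $\grave{x}_j$. $\mathcal{C}$ is the real associative unital algebra generated by $e_1,\ldots,e_m,\grave{e}_1,\ldots,\grave{e}_{2n}$ with relations $e_je_k+e_ke_j=-2\delta_{jk}$, $\grave{e}_{2j}\grave{e}_{2k}-\grave{e}_{2k}\grave{e}_{2j}=0$, $\grave{e}_{2j-1}\grave{e}_{2k-1}-\grave{e}_{2k-1}\grave{e}_{2j-1}=0$, $\grave{e}_{2j-1}\grave{e}_{2k}-\grave{e}_{2k}\grave{e}_{2j-1}=\delta_{jk}$, $e_j\grave{e}_k+\grave{e}_ke_j=0$. All $e_i,\grave{e}_j$ commute with all $x_i,\grave{x}_j$. Vector variables: $\underline{x}=\sum_{i=1}^m x_ie_i$, $\underline{\grave{x}}=\sum_{j=1}^{2n}\grave{x}_j\grave{e}_j$, $x=\underline{x}+\underline{\grave{x}}$. One has $\underline{\grave{x}}^2=\sum_{j=1}^n\grave{x}_{2j-1}\grave{x}_{2j}$, and $\underline{\grave{x}}^0=1$. Operators: $\partial_{\grave{x}_j}$ is the left derivative on the Grassmann algebra ($\partial_{\grave{x}_j}(\grave{x}_kF)=\delta_{jk}F-\grave{x}_k\partial_{\grave{x}_j}F$), commuting with the $x_i$, $e_i$, $\grave{e}_i$ and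 $\partial_{x_i}$. The super Laplace operator is $\Delta=\Delta_b+\Delta_f$ with $\Delta_b=-\sum_{j=1}^m\partial_{x_j}^2$ and $\Delta_f=4\sum_{j=1}^n\partial_{\grave{x}_{2j-1}}\partial_{\grave{x}_{2j}}$. Distributions: operators act on elements of $\mathcal{D}'(\mathbb{R}^m)\otimes\Lambda_{2n}\otimes\mathcal{C}$, with $\partial_{x_j}$ acting in the distributional sense on the first factor. $\delta(\underline{x})$ is the Dirac distribution at the origin of $\mathbb{R}^m$, and the super Dirac distribution is $\delta(x)=\delta(\underline{x})\,\grave{x}_1\cdots\grave{x}_{2n}=\delta(\underline{x})\,\underline{\grave{x}}^{2n}/n!$. *)

theory Defs
  imports
    "HOL-Analysis.Analysis"
    "HOL-Analysis.Finite_Function_Topology"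
    "HOL-Library.Type_Length"
begin

section \<open>Free vector spaces, free algebras and ideals\<close>

definition linear_ext :: "('k \<Rightarrow> 'v) \<Rightarrow> ('k \<Rightarrow>\<^sub>0 real) \<Rightarrow> 'v::real_vector" where
  "linear_ext h p = (\<Sum>k\<in>Poly_Mapping.keys p. Poly_Mapping.lookup p k *\<^sub>R h k)"

lemma lookup_scaleR_poly_mapping:
  "Poly_Mapping.lookup (c *\<^sub>R p) k = c *\<^sub>R Poly_Mapping.lookup p k"
  for p :: "'k \<Rightarrow>\<^sub>0 'v::real_vector"
proof -
  have "finite {i. c *\<^sub>R Poly_Mapping.lookup p i \<noteq> 0}"
    by (rule finite_subset[OF _ finite_lookup[of p]]) auto
  then show ?thesis
    by (simp add: scaleR_poly_mapping_def)
qed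

lemma linear_ext_superset:
  assumes "finite A" "Poly_Mapping.keys p \<subseteq> A"
  shows "linear_ext h p = (\<Sum>k\<in>A. Poly_Mapping.lookup p k *\<^sub>R h k)"
  unfolding linear_ext_def using assms
  by (intro sum.mono_neutral_left) (auto simp: in_keys_iff)

lemma linear_linear_ext: "linear (linear_ext h)"
proof (rule linearI)
  fix p q :: "'a \<Rightarrow>\<^sub>0 real"
  let ?A = "Poly_Mapping.keys p \<union> Poly_Mapping.keys q"
  have "linear_ext h (p + q) = (\<Sum>k\<in>?A. Poly_Mapping.lookup (p + q) k *\<^sub>R h k)"
    by (rule linear_ext_superset) (auto simp: in_keys_iff lookup_add)
  also have "\<dots> = (\<Sum>k\<in>?A. Poly_Mapping.lookup p k *\<^sub>R h k) + (\<Sum>k\<in>?A. Poly_Mapping.lookup q k *\<^sub>R h k)"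
    by (simp add: lookup_add scaleR_add_left sum.distrib)
  also have "\<dots> = linear_ext h p + linear_ext h q"
    by (simp add: linear_ext_superset[of ?A])
  finally show "linear_ext h (p + q) = linear_ext h p + linear_ext h q" .
next
  fix c :: real and p :: "'a \<Rightarrow>\<^sub>0 real"
  have "linear_ext h (c *\<^sub>R p) = (\<Sum>k\<in>Poly_Mapping.keys p. Poly_Mapping.lookup (c *\<^sub>R p) k *\<^sub>R h k)"
    by (rule linear_ext_superset) (auto simp: in_keys_iff lookup_scaleR_poly_mapping)
  then show "linear_ext h (c *\<^sub>R p) = c *\<^sub>R linear_ext h p"
    by (simp add: linear_ext_def scaleR_sum_right lookup_scaleR_poly_mapping)
qed

lemma linear_ext_single [simp]: "linear_ext h (Poly_Mapping.single k c) = c *\<^sub>R h k"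
  by (cases "c = 0") (simp_all add: linear_ext_def)

lemma poly_mapping_expand:
  "p = (\<Sum>k\<in>Poly_Mapping.keys p. Poly_Mapping.lookup p k *\<^sub>R Poly_Mapping.single k 1)"
  for p :: "'k \<Rightarrow>\<^sub>0 real"
proof (rule poly_mapping_eqI)
  fix i
  have "(\<Sum>k\<in>Poly_Mapping.keys p. Poly_Mapping.lookup (Poly_Mapping.lookup p k *\<^sub>R Poly_Mapping.single k 1) i) =
      (\<Sum>k\<in>Poly_Mapping.keys p. if i = k then Poly_Mapping.lookup p k else 0)"
    by (rule sum.cong) (auto simp: lookup_scaleR_poly_mapping lookup_single)
  then show "Poly_Mapping.lookup p i = Poly_Mapping.lookup
      (\<Sum>k\<in>Poly_Mapping.keys p. Poly_Mapping.lookup p k *\<^sub>R Poly_Mapping.single k 1) i"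
    by (simp add: lookup_sum in_keys_iff)
qed

lemma poly_mapping_linear_induct [case_names single add scale zero]:
  fixes p :: "'k \<Rightarrow>\<^sub>0 real"
  assumes single: "\<And>k. P (Poly_Mapping.single k 1)"
    and add: "\<And>p q. P p \<Longrightarrow> P q \<Longrightarrow> P (p + q)"
    and scale: "\<And>c p. P p \<Longrightarrow> P (c *\<^sub>R p)"
    and zero: "P 0"
  shows "P p"
proof -
  have "P (\<Sum>k\<in>A. Poly_Mapping.lookup p k *\<^sub>R Poly_Mapping.single k 1)" if "finite A" for A
    using that by (induction A rule: finite_induct) (auto intro: assms)
  then show ?thesis
    using poly_mapping_expand[of p] by (metis finite_keys)
qed

instance poly_mapping :: (monoid_add, real_algebra_1) real_algebra
proof
  fix c :: real and p q :: "'a \<Rightarrow>\<^sub>0 'b"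
  have s: "c *\<^sub>R r = Poly_Mapping.single 0 (of_real c) * r" for r :: "'a \<Rightarrow>\<^sub>0 'b"
  proof (rule poly_mapping_eqI)
    fix k
    have "Poly_Mapping.single 0 (of_real c) * r = Poly_Mapping.map ((*) (of_real c)) r"
      by (simp add: mult_map_scale_conv_mult)
    then show "Poly_Mapping.lookup (c *\<^sub>R r) k = Poly_Mapping.lookup (Poly_Mapping.single 0 (of_real c) * r) k"
      by (simp add: lookup_scaleR_poly_mapping map.rep_eq when_def scaleR_conv_of_real)
  qed
  have comm: "p * Poly_Mapping.single 0 (of_real c) = Poly_Mapping.single 0 (of_real c) * p"
  proof (induction p rule: update_induct)
    case const
    then show ?case by simp
  next
    case (update f a b)
    have "Poly_Mapping.update a b f = Poly_Mapping.single a b + f"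
      using update
      by (intro poly_mapping_eqI) (auto simp: lookup_update lookup_add lookup_single when_def in_keys_iff)
    with update show ?case
      by (simp add: algebra_simps mult_single of_real_def)
  qed
  show "c *\<^sub>R p * q = c *\<^sub>R (p * q)"
    by (simp add: s mult.assoc)
  show "p * c *\<^sub>R q = c *\<^sub>R (p * q)"
    by (simp add: s comm flip: mult.assoc)
qed

datatype 'g word = Word (letters: "'g list")

instantiation word :: (type) monoid_add
begin
definition "0 = Word []"
definition "u + v = Word (letters u @ letters v)"
instance by standard (auto simp: zero_word_def plus_word_def)
end

type_synonym 'g free_algebra = "'g word \<Rightarrow>\<^sub>0 real"

definition gen :: "'g \<Rightarrow> 'g free_algebra" where
  "gen g = Poly_Mapping.single (Word [g]) 1"

definition ideal_of :: "'a set \<Rightarrow> ('a::real_algebra) set" where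
  "ideal_of R = span {u * r * v | u r v. r \<in> R}"

lemma equivp_span: "equivp (\<lambda>p q. p - q \<in> span S)"
proof (rule equivpI)
  show "reflp (\<lambda>p q. p - q \<in> span S)"
    by (auto intro!: reflpI span_zero)
  show "symp (\<lambda>p q. p - q \<in> span S)"
    by (rule sympI) (metis minus_diff_eq span_neg)
  show "transp (\<lambda>p q. p - q \<in> span S)"
    by (rule transpI) (metis diff_add_cancel add_diff_eq span_add)
qed

lemma span_respects:
  assumes "p - p' \<in> span S"
  shows "- p - (- p') \<in> span S"
    and "c *\<^sub>R p - c *\<^sub>R p' \<in> span S"
    and "q - q' \<in> span S \<Longrightarrow> p + q - (p' + q') \<in> span S"
    and "q - q' \<in> span S \<Longrightarrow> p - q - (p' - q') \<in> span S"
proof -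
  show "- p - (- p') \<in> span S"
    using span_neg[OF assms] by (simp add: algebra_simps)
  show "c *\<^sub>R p - c *\<^sub>R p' \<in> span S"
    using span_scale[OF assms, of c] by (simp add: algebra_simps)
  assume q: "q - q' \<in> span S"
  show "p + q - (p' + q') \<in> span S"
    using span_add[OF assms q] by (simp add: algebra_simps)
  show "p - q - (p' - q') \<in> span S"
    using span_diff[OF assms q] by (simp add: algebra_simps)
qed

lemma equivp_ideal_of: "equivp (\<lambda>p q. p - q \<in> ideal_of R)"
  unfolding ideal_of_def by (rule equivp_span)

lemma ideal_of_generator: "r \<in> R \<Longrightarrow> r \<in> ideal_of R"
  for r :: "'a::{real_algebra, monoid_mult}"
  unfolding ideal_of_def by (rule span_base) (metis (mono_tags, lifting) mem_Collect_eq mult.left_neutral mult.right_neutral)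

lemma ideal_of_add: "p \<in> ideal_of R \<Longrightarrow> q \<in> ideal_of R \<Longrightarrow> p + q \<in> ideal_of R"
  unfolding ideal_of_def by (rule span_add)

lemma ideal_of_diff: "p \<in> ideal_of R \<Longrightarrow> q \<in> ideal_of R \<Longrightarrow> p - q \<in> ideal_of R"
  unfolding ideal_of_def by (rule span_diff)

lemma ideal_of_uminus: "p \<in> ideal_of R \<Longrightarrow> - p \<in> ideal_of R"
  unfolding ideal_of_def by (rule span_neg)

lemma ideal_of_scaleR: "p \<in> ideal_of R \<Longrightarrow> c *\<^sub>R p \<in> ideal_of R"
  unfolding ideal_of_def by (rule span_scale)

lemma ideal_of_mult_left: "p \<in> ideal_of R \<Longrightarrow> a * p \<in> ideal_of R"
  unfolding ideal_of_def
proof (induction rule: span_induct_alt)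
  case base
  then show ?case by (simp add: span_zero)
next
  case (step c x y)
  then obtain u r v where "x = u * r * v" "r \<in> R"
    by blast
  then have "a * x \<in> span {u * r * v | u r v. r \<in> R}"
    by (intro span_base) (auto simp flip: mult.assoc)
  with step show ?case
    by (simp add: distrib_left span_add span_scale)
qed

lemma ideal_of_mult_right: "p \<in> ideal_of R \<Longrightarrow> p * a \<in> ideal_of R"
  unfolding ideal_of_def
proof (induction rule: span_induct_alt)
  case base
  then show ?case by (simp add: span_zero)
next
  case (step c x y)
  then obtain u r v where "x = u * r * v" "r \<in> R"
    by blast
  then have "x * a \<in> span {u * r * v | u r v. r \<in> R}"
    by (intro span_base) (auto simp: mult.assoc)
  with step show ?case
    by (simp add: distrib_right span_add span_scale)
qed

lemma ideal_of_respects_linear: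
  assumes "p - p' \<in> ideal_of R"
  shows "- p - (- p') \<in> ideal_of R"
    and "c *\<^sub>R p - c *\<^sub>R p' \<in> ideal_of R"
    and "q - q' \<in> ideal_of R \<Longrightarrow> p + q - (p' + q') \<in> ideal_of R"
    and "q - q' \<in> ideal_of R \<Longrightarrow> p - q - (p' - q') \<in> ideal_of R"
  using span_respects assms unfolding ideal_of_def by blast+

lemma ideal_of_respects_times:
  assumes "p - p' \<in> ideal_of R" "q - q' \<in> ideal_of R"
  shows "p * q - p' * q' \<in> ideal_of R"
  using ideal_of_add[OF ideal_of_mult_right[OF assms(1), of q] ideal_of_mult_left[OF assms(2), of p']]
  by (simp add: algebra_simps)


lemma quotient_algebra_laws:
  "a + b + c - (a + (b + c)) = 0" "a + b - (b + a) = 0" "0 + a - a = 0" "- a + a - 0 = 0"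
  "a - b - (a + - b) = 0"
  "r *\<^sub>R (a + b) - (r *\<^sub>R a + r *\<^sub>R b) = 0" "(r + s) *\<^sub>R a - (r *\<^sub>R a + s *\<^sub>R a) = 0"
  "r *\<^sub>R s *\<^sub>R a - (r * s) *\<^sub>R a = 0" "1 *\<^sub>R a - a = 0"
  "0 \<in> span S" "0 \<in> ideal_of R"
  for a b c :: "'a::real_vector" and r s :: real
  by (simp_all add: algebra_simps span_zero ideal_of_def)

section \<open>The Grassmann algebra\<close>

text \<open>The type parameter \<open>'n\<close> carries the number \<open>n = LENGTH('n)\<close>, which may be any natural
  number including 0 (\<open>LENGTH(0) = 0\<close>). The free algebra has a generator for every natural number;
  those whose index lies outside \<open>{1..2 * n}\<close> are set to 0, so that exactly the generators
  \<open>1, \<dots>, 2 * n\<close> remain.\<close>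

definition grassmann_rels :: "'n::len0 itself \<Rightarrow> nat free_algebra set" where
  "grassmann_rels _ =
     {gen i * gen j + gen j * gen i | i j. i \<in> {1..2 * LENGTH('n)} \<and> j \<in> {1..2 * LENGTH('n)}} \<union>
     {gen i | i. i \<notin> {1..2 * LENGTH('n)}}"

quotient_type (overloaded) 'n grassmann = "nat free_algebra" / "\<lambda>p q. p - q \<in> ideal_of (grassmann_rels TYPE('n::len0))"
  by (rule equivp_ideal_of)

instantiation grassmann :: (len0) "{real_algebra, monoid_mult}"
begin
lift_definition zero_grassmann :: "'a grassmann" is 0 .
lift_definition one_grassmann :: "'a grassmann" is 1 .
lift_definition plus_grassmann :: "'a grassmann \<Rightarrow> 'a grassmann \<Rightarrow> 'a grassmann" is "(+)"
  by (rule ideal_of_respects_linear)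
lift_definition minus_grassmann :: "'a grassmann \<Rightarrow> 'a grassmann \<Rightarrow> 'a grassmann" is "(-)"
  by (rule ideal_of_respects_linear)
lift_definition uminus_grassmann :: "'a grassmann \<Rightarrow> 'a grassmann" is uminus
  by (rule ideal_of_respects_linear)
lift_definition times_grassmann :: "'a grassmann \<Rightarrow> 'a grassmann \<Rightarrow> 'a grassmann" is "(*)"
  by (rule ideal_of_respects_times)
lift_definition scaleR_grassmann :: "real \<Rightarrow> 'a grassmann \<Rightarrow> 'a grassmann" is scaleR
  by (rule ideal_of_respects_linear)
instance
  by standard (transfer; simp only: quotient_algebra_laws mult.assoc mult_1_left mult_1_right distrib_left distrib_right mult_scaleR_left mult_scaleR_right diff_self)+
end

lift_definition grave_x :: "nat \<Rightarrow> 'n::len0 grassmann" is gen .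

text \<open>The left derivative is first defined on words, following
  \<open>\<partial>\<^sub>j (x\<^sub>k F) = \<delta>\<^sub>j\<^sub>k F - x\<^sub>k \<partial>\<^sub>j F\<close>, and then descends to the quotient.\<close>

primrec word_deriv :: "nat \<Rightarrow> nat list \<Rightarrow> nat free_algebra" where
  "word_deriv j [] = 0"
| "word_deriv j (k # w) = (if j = k then Poly_Mapping.single (Word w) 1 else 0) - gen k * word_deriv j w"

definition free_deriv :: "nat \<Rightarrow> nat free_algebra \<Rightarrow> nat free_algebra" where
  "free_deriv j = linear_ext (\<lambda>w. word_deriv j (letters w))"

lemma linear_free_deriv: "linear (free_deriv j)"
  unfolding free_deriv_def by (rule linear_linear_ext)

lemma gen_mult_single: "gen k * Poly_Mapping.single w 1 = Poly_Mapping.single (Word (k # letters w)) 1"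
  by (simp add: gen_def mult_single plus_word_def)

lemma free_deriv_gen_mult:
  "free_deriv j (gen k * p) = (if j = k then p else 0) - gen k * free_deriv j p"
proof (induction p rule: poly_mapping_linear_induct)
  case (single w)
  then show ?case
    by (cases w) (simp add: gen_mult_single free_deriv_def)
qed (simp_all add: distrib_left linear_add[OF linear_free_deriv] linear_cmul[OF linear_free_deriv]
    linear_0[OF linear_free_deriv] scaleR_diff_right)

lemma free_deriv_ideal:
  assumes j: "j \<in> {1..2 * LENGTH('n::len0)}" and p: "p \<in> ideal_of (grassmann_rels TYPE('n))"
  shows "free_deriv j p \<in> ideal_of (grassmann_rels TYPE('n))"
proof -
  let ?I = "ideal_of (grassmann_rels TYPE('n))"
  note lin = linear_add[OF linear_free_deriv] linear_cmul[OF linear_free_deriv] linear_0[OF linear_free_deriv]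
  have zero: "0 \<in> ?I"
    by (simp add: ideal_of_def span_zero)
  have base: "free_deriv j (r * v) \<in> ?I" if r: "r \<in> grassmann_rels TYPE('n)" for r v
  proof -
    from r consider a b where "r = gen a * gen b + gen b * gen a"
      | a where "r = gen a" "a \<noteq> j"
      using j unfolding grassmann_rels_def by blast
    then have "free_deriv j (r * v) = r * free_deriv j v \<or> free_deriv j (r * v) = - (r * free_deriv j v)"
    proof cases
      case 1
      then show ?thesis
        by (simp add: distrib_right mult.assoc lin free_deriv_gen_mult algebra_simps)
    next
      case 2
      then show ?thesis
        by (simp add: free_deriv_gen_mult)
    qed
    moreover have "r * free_deriv j v \<in> ?I"
      by (intro ideal_of_mult_right ideal_of_generator r)
    ultimately show ?thesis
      using ideal_of_uminus by auto
  qed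
  have word: "free_deriv j (Poly_Mapping.single (Word w) 1 * (r * v)) \<in> ?I"
    if r: "r \<in> grassmann_rels TYPE('n)" for w r v
  proof (induction w)
    case Nil
    then show ?case
      using base[OF r, of v] by (simp flip: zero_word_def)
  next
    case (Cons k w)
    let ?q = "Poly_Mapping.single (Word w) 1 * (r * v)"
    have "?q \<in> ?I"
      by (intro ideal_of_mult_left ideal_of_mult_right ideal_of_generator r)
    moreover have "Poly_Mapping.single (Word (k # w)) 1 * (r * v) = gen k * ?q"
      using gen_mult_single[of k "Word w"] by (simp flip: mult.assoc)
    moreover have "(if j = k then ?q else 0) - gen k * free_deriv j ?q \<in> ?I" if "?q \<in> ?I"
      by (intro ideal_of_diff ideal_of_mult_left Cons) (use that zero in auto)
    ultimately show ?case
      by (simp only: free_deriv_gen_mult)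
  qed
  have all: "free_deriv j (u * (r * v)) \<in> ?I" if r: "r \<in> grassmann_rels TYPE('n)" for u r v
  proof (induction u rule: poly_mapping_linear_induct)
    case (single k)
    then show ?case
      using word[OF r, of "letters k" v] by simp
  qed (simp_all add: distrib_right lin ideal_of_add ideal_of_scaleR zero)
  from p show ?thesis
    unfolding ideal_of_def[of "grassmann_rels TYPE('n)"]
  proof (induction rule: span_induct_alt)
    case base
    then show ?case by (simp add: lin span_zero)
  next
    case (step c x y)
    then obtain u r v where "x = u * r * v" "r \<in> grassmann_rels TYPE('n)"
      by blast
    then have "free_deriv j x \<in> span {u * r * v | u r v. r \<in> grassmann_rels TYPE('n)}"
      using all[of r u v] by (simp add: ideal_of_def mult.assoc)
    with step show ?case
      by (simp add: lin span_add span_scale)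
  qed
qed

lift_definition grassmann_deriv :: "nat \<Rightarrow> 'n::len0 grassmann \<Rightarrow> 'n grassmann" is
  "\<lambda>j p. if j \<in> {1..2 * LENGTH('n)} then free_deriv j p else 0"
proof -
  fix j and p q :: "nat free_algebra"
  assume "p - q \<in> ideal_of (grassmann_rels TYPE('n))"
  then show "(if j \<in> {1..2 * LENGTH('n)} then free_deriv j p else 0) -
      (if j \<in> {1..2 * LENGTH('n)} then free_deriv j q else 0) \<in> ideal_of (grassmann_rels TYPE('n))"
    using free_deriv_ideal[of j "p - q", where 'n = 'n]
    by (auto simp: linear_diff[OF linear_free_deriv] ideal_of_def span_zero)
qed

lemma grave_x_anticommute:
  assumes "i \<in> {1..2 * LENGTH('n)}" "j \<in> {1..2 * LENGTH('n)}"
  shows "grave_x i * grave_x j = - (grave_x j * (grave_x i :: 'n::len0 grassmann))"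
proof -
  have "(gen i * gen j - - (gen j * gen i) :: nat free_algebra) \<in> ideal_of (grassmann_rels TYPE('n))"
    using assms by (intro ideal_of_generator) (auto simp: grassmann_rels_def)
  then show ?thesis
    by transfer
qed

lemma linear_grassmann_deriv: "linear (grassmann_deriv j :: 'n::len0 grassmann \<Rightarrow> 'n grassmann)"
proof (rule linearI)
  fix F G :: "'n grassmann" and c :: real
  show "grassmann_deriv j (F + G) = grassmann_deriv j F + grassmann_deriv j G"
  proof (induction F, induction G)
    case (1 p q)
    then show ?case
      by (simp add: plus_grassmann.abs_eq grassmann_deriv.abs_eq linear_add[OF linear_free_deriv])
  qed
  show "grassmann_deriv j (c *\<^sub>R F) = c *\<^sub>R grassmann_deriv j F"
  proof (induction F)
    case (1 p)
    then show ?case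
      by (simp add: scaleR_grassmann.abs_eq grassmann_deriv.abs_eq linear_cmul[OF linear_free_deriv])
  qed
qed

lemma grassmann_deriv_one: "grassmann_deriv j (1 :: 'n::len0 grassmann) = 0"
proof -
  have "free_deriv j 1 = 0"
    unfolding free_deriv_def single_one[symmetric] linear_ext_single by (simp add: zero_word_def)
  then show ?thesis
    by transfer (simp add: ideal_of_def span_zero)
qed

lemma grassmann_deriv_grave_x_mult:
  assumes "j \<in> {1..2 * LENGTH('n)}"
  shows "grassmann_deriv j (grave_x k * (F :: 'n::len0 grassmann)) =
    (if j = k then F else 0) - grave_x k * grassmann_deriv j F"
proof (induction F)
  case (1 p)
  then show ?case
    using assms
    by (simp add: grave_x.abs_eq times_grassmann.abs_eq grassmann_deriv.abs_eq minus_grassmann.abs_eq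
        free_deriv_gen_mult uminus_grassmann.abs_eq)
qed


section \<open>The orthosymplectic Clifford-Weyl algebra\<close>

datatype 'm clifford_gen = E 'm | Grave_E nat

text \<open>As above, the generators \<open>Grave_E k\<close> with \<open>k\<close> outside \<open>{1..2 * LENGTH('n)}\<close> are set to 0.\<close>

definition clifford_rels :: "'m itself \<Rightarrow> 'n::len0 itself \<Rightarrow> 'm clifford_gen free_algebra set" where
  "clifford_rels _ _ =
     {gen (E j) * gen (E k) + gen (E k) * gen (E j) - (if j = k then -2 else 0) | j k. True} \<union>
     {gen (Grave_E (2 * j)) * gen (Grave_E (2 * k)) - gen (Grave_E (2 * k)) * gen (Grave_E (2 * j)) | j k.
        j \<in> {1..LENGTH('n)} \<and> k \<in> {1..LENGTH('n)}} \<union>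
     {gen (Grave_E (2 * j - 1)) * gen (Grave_E (2 * k - 1)) -
        gen (Grave_E (2 * k - 1)) * gen (Grave_E (2 * j - 1)) | j k.
        j \<in> {1..LENGTH('n)} \<and> k \<in> {1..LENGTH('n)}} \<union>
     {gen (Grave_E (2 * j - 1)) * gen (Grave_E (2 * k)) -
        gen (Grave_E (2 * k)) * gen (Grave_E (2 * j - 1)) - (if j = k then 1 else 0) | j k.
        j \<in> {1..LENGTH('n)} \<and> k \<in> {1..LENGTH('n)}} \<union>
     {gen (E j) * gen (Grave_E k) + gen (Grave_E k) * gen (E j) | j k. k \<in> {1..2 * LENGTH('n)}} \<union>
     {gen (Grave_E k) | k. k \<notin> {1..2 * LENGTH('n)}}"

quotient_type (overloaded) ('m, 'n) clifford = "'m clifford_gen free_algebra" /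
    "\<lambda>p q. p - q \<in> ideal_of (clifford_rels TYPE('m) TYPE('n::len0))"
  by (rule equivp_ideal_of)

instantiation clifford :: (type, len0) "{real_algebra, monoid_mult}"
begin
lift_definition zero_clifford :: "('a, 'b) clifford" is 0 .
lift_definition one_clifford :: "('a, 'b) clifford" is 1 .
lift_definition plus_clifford :: "('a, 'b) clifford \<Rightarrow> ('a, 'b) clifford \<Rightarrow> ('a, 'b) clifford" is "(+)"
  by (rule ideal_of_respects_linear)
lift_definition minus_clifford :: "('a, 'b) clifford \<Rightarrow> ('a, 'b) clifford \<Rightarrow> ('a, 'b) clifford" is "(-)"
  by (rule ideal_of_respects_linear)
lift_definition uminus_clifford :: "('a, 'b) clifford \<Rightarrow> ('a, 'b) clifford" is uminus
  by (rule ideal_of_respects_linear)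
lift_definition times_clifford :: "('a, 'b) clifford \<Rightarrow> ('a, 'b) clifford \<Rightarrow> ('a, 'b) clifford" is "(*)"
  by (rule ideal_of_respects_times)
lift_definition scaleR_clifford :: "real \<Rightarrow> ('a, 'b) clifford \<Rightarrow> ('a, 'b) clifford" is scaleR
  by (rule ideal_of_respects_linear)
instance
  by standard (transfer; simp only: quotient_algebra_laws mult.assoc mult_1_left mult_1_right distrib_left distrib_right mult_scaleR_left mult_scaleR_right diff_self)+
end

lift_definition clifford_e :: "'m \<Rightarrow> ('m, 'n::len0) clifford" is "\<lambda>i. gen (E i)" .
lift_definition clifford_grave_e :: "nat \<Rightarrow> ('m, 'n::len0) clifford" is "\<lambda>j. gen (Grave_E j)" .


section \<open>Tensor products of real vector spaces and algebras\<close>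

definition tensor_rels :: "(('a::real_vector \<times> 'b::real_vector) \<Rightarrow>\<^sub>0 real) set" where
  "tensor_rels =
     {Poly_Mapping.single (a + a', b) 1 - Poly_Mapping.single (a, b) 1 - Poly_Mapping.single (a', b) 1 | a a' b. True} \<union>
     {Poly_Mapping.single (a, b + b') 1 - Poly_Mapping.single (a, b) 1 - Poly_Mapping.single (a, b') 1 | a b b'. True} \<union>
     {Poly_Mapping.single (c *\<^sub>R a, b) 1 - c *\<^sub>R Poly_Mapping.single (a, b) 1 | c a b. True} \<union>
     {Poly_Mapping.single (a, c *\<^sub>R b) 1 - c *\<^sub>R Poly_Mapping.single (a, b) 1 | c a b. True}"

quotient_type (overloaded) ('a, 'b) tensor = "('a::real_vector \<times> 'b::real_vector) \<Rightarrow>\<^sub>0 real" /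
    "\<lambda>p q. p - q \<in> span tensor_rels"
  by (rule equivp_span)

instantiation tensor :: (real_vector, real_vector) real_vector
begin
lift_definition zero_tensor :: "('a, 'b) tensor" is 0 .
lift_definition plus_tensor :: "('a, 'b) tensor \<Rightarrow> ('a, 'b) tensor \<Rightarrow> ('a, 'b) tensor" is "(+)"
  by (rule span_respects)
lift_definition minus_tensor :: "('a, 'b) tensor \<Rightarrow> ('a, 'b) tensor \<Rightarrow> ('a, 'b) tensor" is "(-)"
  by (rule span_respects)
lift_definition uminus_tensor :: "('a, 'b) tensor \<Rightarrow> ('a, 'b) tensor" is uminus
  by (rule span_respects)
lift_definition scaleR_tensor :: "real \<Rightarrow> ('a, 'b) tensor \<Rightarrow> ('a, 'b) tensor" is scaleR
  by (rule span_respects)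
instance
  by standard (transfer; simp only: quotient_algebra_laws mult.assoc mult_1_left mult_1_right distrib_left distrib_right mult_scaleR_left mult_scaleR_right diff_self)+
end

lift_definition tensor :: "'a::real_vector \<Rightarrow> 'b::real_vector \<Rightarrow> ('a, 'b) tensor" (infixr "\<otimes>" 75) is
  "\<lambda>a b. Poly_Mapping.single (a, b) 1" .

lemma tensor_linear:
  "(a + a') \<otimes> b = a \<otimes> b + a' \<otimes> b"
  "a \<otimes> (b + b') = a \<otimes> b + a \<otimes> b'"
  "(c *\<^sub>R a) \<otimes> b = c *\<^sub>R (a \<otimes> b)"
  "a \<otimes> (c *\<^sub>R b) = c *\<^sub>R (a \<otimes> b)"
  by (transfer; rule span_base; force simp: tensor_rels_def diff_diff_eq)+

lemma bilinear_tensor: "bilinear (\<otimes>)"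
  by (simp add: bilinear_def linear_iff tensor_linear)

lemma tensor_induct [case_names tensor add scale zero]:
  fixes t :: "('a::real_vector, 'b::real_vector) tensor"
  assumes tensor: "\<And>a b. P (a \<otimes> b)"
    and add: "\<And>s t. P s \<Longrightarrow> P t \<Longrightarrow> P (s + t)"
    and scale: "\<And>c t. P t \<Longrightarrow> P (c *\<^sub>R t)"
    and zero: "P 0"
  shows "P t"
proof (induction t)
  case (1 p)
  show ?case
  proof (induction p rule: poly_mapping_linear_induct)
    case (single k)
    then show ?case
      using tensor[of "fst k" "snd k"] by (simp add: tensor.abs_eq)
  next
    case (add p q)
    then show ?case
      using assms(2)[OF add] by (simp add: plus_tensor.abs_eq)
  next
    case (scale c p)
    then show ?case
      using assms(3)[OF scale] by (simp add: scaleR_tensor.abs_eq)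
  next
    case zero
    then show ?case
      using assms(4) by (simp add: zero_tensor_def)
  qed
qed

lift_definition tensor_lift ::
    "('a::real_vector \<Rightarrow> 'b::real_vector \<Rightarrow> 'c::real_vector) \<Rightarrow> ('a, 'b) tensor \<Rightarrow> 'c" is
  "\<lambda>h. if bilinear h then linear_ext (\<lambda>(a, b). h a b) else (\<lambda>_. 0)"
proof -
  fix h :: "'a \<Rightarrow> 'b \<Rightarrow> 'c" and p q :: "('a \<times> 'b) \<Rightarrow>\<^sub>0 real"
  assume pq: "p - q \<in> span tensor_rels"
  show "(if bilinear h then linear_ext (\<lambda>(a, b). h a b) else (\<lambda>_. 0)) p =
        (if bilinear h then linear_ext (\<lambda>(a, b). h a b) else (\<lambda>_. 0)) q"
  proof (cases "bilinear h")
    case True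
    let ?L = "linear_ext (\<lambda>(a, b). h a b)"
    note lin = linear_linear_ext[of "\<lambda>(a, b). h a b"]
    from pq have "?L (p - q) = 0"
    proof (induction rule: span_induct_alt)
      case base
      then show ?case by (simp add: linear_0[OF lin])
    next
      case (step c x y)
      then have "?L x = 0"
        by (auto simp: tensor_rels_def linear_diff[OF lin] linear_cmul[OF lin]
            bilinear_ladd[OF True] bilinear_radd[OF True] bilinear_lmul[OF True] bilinear_rmul[OF True])
      with step show ?case
        by (simp add: linear_add[OF lin] linear_cmul[OF lin])
    qed
    then show ?thesis
      by (simp add: True linear_diff[OF lin])
  qed simp
qed

lemma tensor_lift_tensor: "bilinear h \<Longrightarrow> tensor_lift h (a \<otimes> b) = h a b"
  by transfer simp

lemma linear_tensor_lift: "linear (tensor_lift h)"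
  by (rule linearI; transfer;
      simp add: linear_add[OF linear_linear_ext] linear_cmul[OF linear_linear_ext])

definition tensor_map ::
    "('a::real_vector \<Rightarrow> 'c::real_vector) \<Rightarrow> ('b::real_vector \<Rightarrow> 'd::real_vector) \<Rightarrow>
      ('a, 'b) tensor \<Rightarrow> ('c, 'd) tensor" where
  "tensor_map f g = tensor_lift (\<lambda>a b. f a \<otimes> g b)"

lemma tensor_map_tensor:
  assumes "linear f" "linear g"
  shows "tensor_map f g (a \<otimes> b) = f a \<otimes> g b"
proof -
  have "bilinear (\<lambda>a b. f a \<otimes> g b)"
    using assms by (simp add: bilinear_def linear_iff tensor_linear)
  then show ?thesis
    by (simp add: tensor_map_def tensor_lift_tensor)
qed

lemma linear_tensor_map: "linear (tensor_map f g)"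
  unfolding tensor_map_def by (rule linear_tensor_lift)

definition tensor_times ::
    "('a::real_algebra, 'b::real_algebra) tensor \<Rightarrow> ('a, 'b) tensor \<Rightarrow> ('a, 'b) tensor" where
  "tensor_times s t = tensor_lift (\<lambda>a b. tensor_lift (\<lambda>c d. (a * c) \<otimes> (b * d)) t) s"

lemma bilinear_tensor_mult: "bilinear (\<lambda>c d. (a * c) \<otimes> (b * d))"
  for a :: "'a::real_algebra" and b :: "'b::real_algebra"
  by (simp add: bilinear_def linear_iff tensor_linear distrib_left)

lemma bilinear_tensor_lift_mult:
  "bilinear (\<lambda>a b. tensor_lift (\<lambda>c d. (a * c) \<otimes> (b * d)) t)"
  for t :: "('a::real_algebra, 'b::real_algebra) tensor"
proof -
  have *: "bilinear (\<lambda>a b. (a * c) \<otimes> (b * d))" for c :: 'a and d :: 'b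
    by (simp add: bilinear_def linear_iff tensor_linear distrib_right)
  note l = linear_add[OF linear_tensor_lift] linear_cmul[OF linear_tensor_lift] linear_0[OF linear_tensor_lift]
  note b = tensor_lift_tensor[OF bilinear_tensor_mult] tensor_lift_tensor[OF *]
  show ?thesis
  proof (induction t rule: tensor_induct)
    case (tensor c d)
    then show ?case using * by (simp add: b)
  next
    case (add s t)
    then show ?case unfolding bilinear_def linear_iff by (simp add: l algebra_simps)
  next
    case (scale c t)
    then show ?case unfolding bilinear_def linear_iff by (simp add: l algebra_simps)
  next
    case zero
    then show ?case unfolding bilinear_def linear_iff by (simp add: l)
  qed
qed

lemma tensor_times_tensor: "tensor_times (a \<otimes> b) (c \<otimes> d) = (a * c) \<otimes> (b * d)"
  unfolding tensor_times_def tensor_lift_tensor[OF bilinear_tensor_lift_mult]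
  by (rule tensor_lift_tensor[OF bilinear_tensor_mult])

lemma bilinear_tensor_times: "bilinear tensor_times"
proof -
  note l = linear_add[OF linear_tensor_lift] linear_cmul[OF linear_tensor_lift] linear_0[OF linear_tensor_lift]
  have "linear (\<lambda>t. tensor_times s t)" for s :: "('a, 'b) tensor"
  proof (induction s rule: tensor_induct)
    case (tensor a b)
    then show ?case
      by (simp add: tensor_times_def tensor_lift_tensor bilinear_tensor_lift_mult linear_tensor_lift)
  qed (simp_all add: tensor_times_def l linear_iff algebra_simps)
  moreover have "linear (\<lambda>s. tensor_times s t)" for t :: "('a, 'b) tensor"
    unfolding tensor_times_def by (rule linear_tensor_lift)
  ultimately show ?thesis
    by (simp add: bilinear_def)
qed

instantiation tensor :: (real_algebra, real_algebra) real_algebra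
begin
definition times_tensor :: "('a, 'b) tensor \<Rightarrow> ('a, 'b) tensor \<Rightarrow> ('a, 'b) tensor" where
  "times_tensor = tensor_times"
instance
proof
  note b = bilinear_ladd[OF bilinear_tensor_times] bilinear_radd[OF bilinear_tensor_times]
    bilinear_lmul[OF bilinear_tensor_times] bilinear_rmul[OF bilinear_tensor_times]
    bilinear_lzero[OF bilinear_tensor_times] bilinear_rzero[OF bilinear_tensor_times]
  fix r s t :: "('a, 'b) tensor" and c :: real
  show "(r + s) * t = r * t + s * t" "r * (s + t) = r * s + r * t"
    "c *\<^sub>R r * s = c *\<^sub>R (r * s)" "r * c *\<^sub>R s = c *\<^sub>R (r * s)"
    by (simp_all add: times_tensor_def b)
  show "r * s * t = r * (s * t)"
    unfolding times_tensor_def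
  proof (induction r rule: tensor_induct)
    case r: (tensor a1 b1)
    show ?case
    proof (induction s rule: tensor_induct)
      case s: (tensor a2 b2)
      show ?case
        by (induction t rule: tensor_induct) (simp_all add: b tensor_times_tensor mult.assoc)
    qed (simp_all add: b)
  qed (simp_all add: b)
qed
end

instantiation tensor :: ("{real_algebra, monoid_mult}", "{real_algebra, monoid_mult}") monoid_mult
begin
definition one_tensor :: "('a, 'b) tensor" where
  "one_tensor = 1 \<otimes> 1"
instance
proof
  fix t :: "('a, 'b) tensor"
  show "1 * t = t"
    by (induction t rule: tensor_induct)
      (simp_all add: distrib_left, simp add: one_tensor_def times_tensor_def tensor_times_tensor)
  show "t * 1 = t"
    by (induction t rule: tensor_induct)
      (simp_all add: distrib_right, simp add: one_tensor_def times_tensor_def tensor_times_tensor)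
qed
end

lemma tensor_mult_tensor: "(a \<otimes> b) * (c \<otimes> d) = (a * c) \<otimes> (b * d)"
  by (simp add: times_tensor_def tensor_times_tensor)


section \<open>Distributions\<close>

definition partial :: "'m \<Rightarrow> (real ^ 'm::finite \<Rightarrow> real) \<Rightarrow> real ^ 'm \<Rightarrow> real" where
  "partial i f x = frechet_derivative f (at x) (axis i 1)"

abbreviation partials :: "'m list \<Rightarrow> (real ^ 'm::finite \<Rightarrow> real) \<Rightarrow> real ^ 'm \<Rightarrow> real" where
  "partials is f \<equiv> foldr partial is f"

text \<open>If all iterated partial derivatives are (totally) differentiable, they are in particular
  continuous, so this is the class \<open>C\<^sup>\<infinity>\<close>.\<close>

definition smooth :: "(real ^ 'm::finite \<Rightarrow> real) \<Rightarrow> bool" where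
  "smooth f \<longleftrightarrow> (\<forall>is x. partials is f differentiable (at x))"

definition support :: "(real ^ 'm::finite \<Rightarrow> real) \<Rightarrow> (real ^ 'm) set" where
  "support f = closure {x. f x \<noteq> 0}"

lemma partial_add:
  assumes "\<And>x. f differentiable (at x)" "\<And>x. g differentiable (at x)"
  shows "partial i (\<lambda>x. f x + g x) = (\<lambda>x. partial i f x + partial i g x)"
proof
  fix x
  have "((\<lambda>x. f x + g x) has_derivative (\<lambda>h. frechet_derivative f (at x) h + frechet_derivative g (at x) h)) (at x)"
    by (intro has_derivative_add frechet_derivative_works[THEN iffD1] assms)
  from fun_cong[OF frechet_derivative_at[OF this], of "axis i 1"]
  show "partial i (\<lambda>x. f x + g x) x = partial i f x + partial i g x"
    by (simp add: partial_def)
qed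

lemma partial_scale:
  assumes "\<And>x. f differentiable (at x)"
  shows "partial i (\<lambda>x. c * f x) = (\<lambda>x. c * partial i f x)"
proof
  fix x
  have "((\<lambda>x. c * f x) has_derivative (\<lambda>h. c * frechet_derivative f (at x) h)) (at x)"
    by (intro has_derivative_mult_right frechet_derivative_works[THEN iffD1] assms)
  from fun_cong[OF frechet_derivative_at[OF this], of "axis i 1"]
  show "partial i (\<lambda>x. c * f x) x = c * partial i f x"
    by (simp add: partial_def)
qed

lemma smooth_differentiable: "smooth f \<Longrightarrow> f differentiable (at x)"
  unfolding smooth_def by (drule spec[of _ "[]"]) simp

lemma partials_add:
  assumes "smooth f" "smooth g"
  shows "partials is (\<lambda>x. f x + g x) = (\<lambda>x. partials is f x + partials is g x)"
  using assms by (induction "is") (simp_all add: smooth_def partial_add)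

lemma partials_scale:
  assumes "smooth f"
  shows "partials is (\<lambda>x. c * f x) = (\<lambda>x. c * partials is f x)"
  using assms by (induction "is") (simp_all add: smooth_def partial_scale)

lemma partials_zero: "partials is (\<lambda>_. 0) = (\<lambda>_. 0)"
proof -
  have "partial i (\<lambda>_. 0) = (\<lambda>_. 0)" for i :: 'a
    by (simp add: partial_def fun_eq_iff)
  then show ?thesis
    by (induction "is") simp_all
qed

lemma partials_partial: "partials is (partial i f) = partials (is @ [i]) f"
  by simp

lemma smooth_add: "smooth f \<Longrightarrow> smooth g \<Longrightarrow> smooth (\<lambda>x. f x + g x)"
  unfolding smooth_def[of "\<lambda>x. f x + g x"] by (simp add: partials_add) (simp add: smooth_def)

lemma smooth_scale: "smooth f \<Longrightarrow> smooth (\<lambda>x. c * f x)"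
  unfolding smooth_def[of "\<lambda>x. c * f x"] by (simp add: partials_scale) (simp add: smooth_def)

lemma smooth_zero: "smooth (\<lambda>_. 0)"
  by (simp add: smooth_def partials_zero)

lemma smooth_partial: "smooth f \<Longrightarrow> smooth (partial i f)"
  unfolding smooth_def partials_partial by blast

lemma support_partial: "support (partial i f) \<subseteq> support f"
proof -
  have "partial i f x = 0" if "x \<notin> support f" for x
  proof -
    have zero: "f y = 0" if "y \<in> - support f" for y
      using that closure_subset[of "{x. f x \<noteq> 0}"] by (auto simp: support_def)
    have "open (- support f)"
      unfolding support_def by (intro open_Compl closed_closure)
    have "(f has_derivative (\<lambda>_. 0)) (at x)"
      by (rule has_derivative_transform_within_open[OF has_derivative_const[of 0] \<open>open (- support f)\<close>])
        (use that in \<open>simp_all add: zero\<close>)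
    from fun_cong[OF frechet_derivative_at[OF this], of "axis i 1"] show ?thesis
      by (simp add: partial_def)
  qed
  then have "{x. partial i f x \<noteq> 0} \<subseteq> support f"
    by blast
  then show ?thesis
    unfolding support_def[of "partial i f"]
    by (rule closure_minimal) (simp add: support_def)
qed

lemma support_add: "support (\<lambda>x. f x + g x) \<subseteq> support f \<union> support g"
  unfolding support_def closure_Un[symmetric] by (rule closure_mono) auto

lemma support_scale: "support (\<lambda>x. c * f x) \<subseteq> support f"
  unfolding support_def by (rule closure_mono) auto

typedef 'm test_function = "{f :: real ^ 'm::finite \<Rightarrow> real. smooth f \<and> compact (support f)}"
  morphisms test_apply Test_function
  by (rule exI[of _ "\<lambda>_. 0"]) (simp add: smooth_zero support_def)

setup_lifting type_definition_test_function

lemma compact_support_subset: "compact K \<Longrightarrow> support f \<subseteq> K \<Longrightarrow> compact (support f)"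
  unfolding support_def by (metis closed_closure compact_Int_closed inf.absorb2)

instantiation test_function :: (finite) real_vector
begin
lift_definition zero_test_function :: "'a test_function" is "\<lambda>_. 0"
  by (simp add: smooth_zero support_def)
lift_definition plus_test_function :: "'a test_function \<Rightarrow> 'a test_function \<Rightarrow> 'a test_function" is
  "\<lambda>f g x. f x + g x"
  by (auto intro!: smooth_add compact_support_subset[OF compact_Un support_add])
lift_definition scaleR_test_function :: "real \<Rightarrow> 'a test_function \<Rightarrow> 'a test_function" is
  "\<lambda>c f x. c * f x"
  by (auto intro: smooth_scale compact_support_subset[OF _ support_scale])
definition uminus_test_function :: "'a test_function \<Rightarrow> 'a test_function" where
  "uminus_test_function f = (-1) *\<^sub>R f"
definition minus_test_function :: "'a test_function \<Rightarrow> 'a test_function \<Rightarrow> 'a test_function" where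
  "minus_test_function f g = f + (- g)"
instance
  by standard (simp_all add: minus_test_function_def uminus_test_function_def,
    (transfer; simp add: fun_eq_iff algebra_simps)+)
end

lift_definition test_partial :: "'m::finite \<Rightarrow> 'm test_function \<Rightarrow> 'm test_function" is partial
  by (auto intro: smooth_partial compact_support_subset[OF _ support_partial])

definition test_null_sequence :: "(nat \<Rightarrow> 'm::finite test_function) \<Rightarrow> bool" where
  "test_null_sequence \<phi> \<longleftrightarrow>
     (\<exists>K. compact K \<and> (\<forall>j. support (test_apply (\<phi> j)) \<subseteq> K)) \<and>
     (\<forall>is. uniform_limit UNIV (\<lambda>j. partials is (test_apply (\<phi> j))) (\<lambda>_. 0) sequentially)"

text \<open>Real-valued distributions. For linear functionals on the space of test functions, sequential
  continuity is equivalent to continuity.\<close>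

typedef 'm distribution = "{T :: 'm::finite test_function \<Rightarrow> real.
    linear T \<and> (\<forall>\<phi>. test_null_sequence \<phi> \<longrightarrow> (\<lambda>j. T (\<phi> j)) \<longlonglongrightarrow> 0)}"
  morphisms distribution_apply Distribution
  by (rule exI[of _ "\<lambda>_. 0"]) (simp add: linear_iff)

setup_lifting type_definition_distribution

instantiation distribution :: (finite) real_vector
begin
lift_definition zero_distribution :: "'a distribution" is "\<lambda>_. 0"
  by (simp add: linear_iff)
lift_definition plus_distribution :: "'a distribution \<Rightarrow> 'a distribution \<Rightarrow> 'a distribution" is
  "\<lambda>S T \<phi>. S \<phi> + T \<phi>"
  by (auto simp: linear_compose_add intro: tendsto_add_zero)
lift_definition scaleR_distribution :: "real \<Rightarrow> 'a distribution \<Rightarrow> 'a distribution" is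
  "\<lambda>c T \<phi>. c * T \<phi>"
  by (auto simp: linear_iff algebra_simps intro: tendsto_mult_right_zero)
definition uminus_distribution :: "'a distribution \<Rightarrow> 'a distribution" where
  "uminus_distribution T = (-1) *\<^sub>R T"
definition minus_distribution :: "'a distribution \<Rightarrow> 'a distribution \<Rightarrow> 'a distribution" where
  "minus_distribution S T = S + (- T)"
instance
  by standard (simp_all add: minus_distribution_def uminus_distribution_def,
    (transfer; simp add: fun_eq_iff algebra_simps)+)
end

lemma linear_test_partial: "linear (test_partial i)"
proof (rule linearI)
  show "test_partial i (f + g) = test_partial i f + test_partial i g" for f g
    by transfer (simp add: partial_add smooth_differentiable)
  show "test_partial i (c *\<^sub>R f) = c *\<^sub>R test_partial i f" for c f
    by transfer (simp add: partial_scale smooth_differentiable)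
qed

lemma test_null_sequence_partial:
  assumes "test_null_sequence \<phi>"
  shows "test_null_sequence (\<lambda>j. test_partial i (\<phi> j))"
proof -
  have "support (test_apply (test_partial i (\<phi> j))) \<subseteq> support (test_apply (\<phi> j))" for j
    by (simp add: test_partial.rep_eq support_partial)
  then show ?thesis
    using assms unfolding test_null_sequence_def test_partial.rep_eq partials_partial by blast
qed

lift_definition distribution_partial :: "'m::finite \<Rightarrow> 'm distribution \<Rightarrow> 'm distribution" is
  "\<lambda>i T \<phi>. - T (test_partial i \<phi>)"
proof (intro conjI allI impI)
  fix i :: 'm and T :: "'m test_function \<Rightarrow> real"
  assume T: "linear T \<and> (\<forall>\<phi>. test_null_sequence \<phi> \<longrightarrow> (\<lambda>j. T (\<phi> j)) \<longlonglongrightarrow> 0)"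
  then show "linear (\<lambda>\<phi>. - T (test_partial i \<phi>))"
    by (simp add: linear_iff linear_add[OF linear_test_partial] linear_cmul[OF linear_test_partial])
  fix \<phi> :: "nat \<Rightarrow> 'm test_function"
  assume "test_null_sequence \<phi>"
  then have "(\<lambda>j. T (test_partial i (\<phi> j))) \<longlonglongrightarrow> 0"
    using T test_null_sequence_partial by blast
  then show "(\<lambda>j. - T (test_partial i (\<phi> j))) \<longlonglongrightarrow> 0"
    using tendsto_minus by fastforce
qed

lemma linear_distribution_partial: "linear (distribution_partial i)"
  by (rule linearI; transfer; simp add: fun_eq_iff)

lift_definition dirac :: "'m::finite distribution" is "\<lambda>\<phi>. test_apply \<phi> 0"
proof (intro conjI allI impI)
  show "linear (\<lambda>\<phi> :: 'm test_function. test_apply \<phi> 0)"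
    by (rule linearI) (simp_all add: plus_test_function.rep_eq scaleR_test_function.rep_eq)
  fix \<phi> :: "nat \<Rightarrow> 'm test_function"
  assume "test_null_sequence \<phi>"
  then have "uniform_limit UNIV (\<lambda>j. partials [] (test_apply (\<phi> j))) (\<lambda>_. 0) sequentially"
    unfolding test_null_sequence_def by blast
  then show "(\<lambda>j. test_apply (\<phi> j) 0) \<longlonglongrightarrow> 0"
    by (auto dest: tendsto_uniform_limitI[where x = 0])
qed

definition laplace_b :: "'m::finite distribution \<Rightarrow> 'm distribution" where
  "laplace_b T = - (\<Sum>i\<in>UNIV. distribution_partial i (distribution_partial i T))"


section \<open>Super distributions and the super Laplace operator\<close>

type_synonym ('m, 'n) super_algebra = "('n grassmann, ('m, 'n) clifford) tensor"
type_synonym ('m, 'n) super_distribution = "('m distribution, ('m, 'n) super_algebra) tensor"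

definition super_partial :: "'m::finite \<Rightarrow> ('m, 'n::len0) super_distribution \<Rightarrow> ('m, 'n) super_distribution" where
  "super_partial i = tensor_map (distribution_partial i) id"

definition super_grave_partial :: "nat \<Rightarrow> ('m::finite, 'n::len0) super_distribution \<Rightarrow> ('m, 'n) super_distribution" where
  "super_grave_partial j = tensor_map id (tensor_map (grassmann_deriv j) id)"

definition super_laplace_b :: "('m::finite, 'n::len0) super_distribution \<Rightarrow> ('m, 'n) super_distribution" where
  "super_laplace_b F = - (\<Sum>i\<in>UNIV. super_partial i (super_partial i F))"

definition super_laplace_f :: "('m::finite, 'n::len0) super_distribution \<Rightarrow> ('m, 'n) super_distribution" where
  "super_laplace_f F =
     4 *\<^sub>R (\<Sum>j\<in>{1..LENGTH('n)}. super_grave_partial (2 * j - 1) (super_grave_partial (2 * j) F))"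

definition super_laplace :: "('m::finite, 'n::len0) super_distribution \<Rightarrow> ('m, 'n) super_distribution" where
  "super_laplace F = super_laplace_b F + super_laplace_f F"

text \<open>The product of tensors is \<open>(a \<otimes> b) * (c \<otimes> d) = (a * c) \<otimes> (b * d)\<close> without signs, because the
  Grassmann variables commute with the generators of the Clifford-Weyl algebra.\<close>

definition grave_vector :: "('m, 'n::len0) super_algebra" where
  "grave_vector = (\<Sum>j\<in>{1..2 * LENGTH('n)}. grave_x j \<otimes> clifford_grave_e j)"

definition super_dirac :: "('m::finite, 'n::len0) super_distribution" where
  "super_dirac = dirac \<otimes> prod_list (map grave_x [1..<2 * LENGTH('n) + 1]) \<otimes> 1"

end

theory Submission
  imports Defs
begin

text \<open>
  Put \<open>\<theta> = \<Sum>\<^sub>j x\<^sub>2\<^sub>j\<^sub>-\<^sub>1 x\<^sub>2\<^sub>j\<close> in the Grassmann algebra. The commutation relations give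
  \<open>grave_vector\<^sup>2 = \<theta> \<otimes> 1\<close>, and since \<open>\<theta>\<close> is even and central,
  \<open>\<Sum>\<^sub>j \<partial>\<^sub>2\<^sub>j\<^sub>-\<^sub>1 \<partial>\<^sub>2\<^sub>j \<theta>\<^sup>s = s (s - 1 - n) \<theta>\<^sup>s\<^sup>-\<^sup>1\<close>. Writing the coefficient \<open>(l + k - 1)! / (k - 1)!\<close> as the
  rising factorial of \<open>k\<close>, the sum in the theorem makes sense for \<open>k = 0\<close> as well, where only the term
  \<open>l = 0\<close>, the super Dirac distribution, survives. The super Laplace operator lowers \<open>k\<close> by one, by
  the recursion of the rising factorial.
\<close>

section \<open>Even elements of the Grassmann algebra\<close>

lemma grave_x_square:
  assumes "i \<in> {1..2 * LENGTH('n)}"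
  shows "grave_x i * grave_x i = (0 :: 'n::len0 grassmann)"
proof -
  have "(2::real) *\<^sub>R (grave_x i * grave_x i :: 'n grassmann) = 0"
    using grave_x_anticommute[OF assms assms] unfolding scaleR_2 by (metis add.right_inverse)
  then show ?thesis
    by simp
qed

definition grave_pair :: "nat \<Rightarrow> 'n::len0 grassmann" where
  "grave_pair j = grave_x (2 * j - 1) * grave_x (2 * j)"

text \<open>The cut-off \<open>q\<close> serves the induction on the number of pairs; the element
  \<theta> itself is the case \<open>q = LENGTH('n)\<close>.\<close>

definition grave_theta :: "nat \<Rightarrow> 'n::len0 grassmann" where
  "grave_theta q = (\<Sum>j = 1..q. grave_pair j)"

text \<open>Moving a generator past a pair costs two sign changes, which cancel. Anticommutation
  includes equal indices, so a generator occurring in the pair is no exception.\<close>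

lemma grave_pair_central:
  assumes "j \<in> {1..LENGTH('n)}" "i \<in> {1..2 * LENGTH('n)}"
  shows "grave_pair j * grave_x i = grave_x i * (grave_pair j :: 'n::len0 grassmann)"
proof -
  have "2 * j - 1 \<in> {1..2 * LENGTH('n)}" "2 * j \<in> {1..2 * LENGTH('n)}"
    using assms by auto
  note anti = this[THEN grave_x_anticommute, OF assms(2)]
  show ?thesis
    by (simp add: grave_pair_def mult.assoc anti(2)) (simp add: anti(1)[simplified] flip: mult.assoc)
qed

lemma grave_pair_commute:
  assumes "i \<in> {1..LENGTH('n)}" "j \<in> {1..LENGTH('n)}"
  shows "grave_pair i * grave_pair j = grave_pair j * (grave_pair i :: 'n::len0 grassmann)"
proof -
  have "2 * j - 1 \<in> {1..2 * LENGTH('n)}" "2 * j \<in> {1..2 * LENGTH('n)}"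
    using assms by auto
  note central = this[THEN grave_pair_central[OF assms(1)]]
  show ?thesis
    unfolding grave_pair_def[of j] by (simp add: mult.assoc flip: central(2)) (simp add: central(1)[simplified] flip: mult.assoc)
qed

text \<open>Centrality brings the two factors \<open>grave_x (2 * j - 1)\<close> together, and they
  square to 0.\<close>

lemma grave_pair_square:
  assumes "j \<in> {1..LENGTH('n)}"
  shows "grave_pair j * grave_pair j = (0 :: 'n::len0 grassmann)"
proof -
  have j: "2 * j - 1 \<in> {1..2 * LENGTH('n)}" "2 * j \<in> {1..2 * LENGTH('n)}"
    using assms by auto
  have "grave_pair j * grave_pair j = grave_x (2 * j - 1) * grave_pair j * (grave_x (2 * j) :: 'n grassmann)"
    unfolding grave_pair_central[OF assms j(1), symmetric] by (simp add: grave_pair_def mult.assoc)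
  also have "grave_x (2 * j - 1) * (grave_pair j :: 'n grassmann) = 0"
    using grave_x_square[OF j(1)] by (simp add: grave_pair_def flip: mult.assoc)
  finally show ?thesis
    by simp
qed

lemma grave_theta_central:
  assumes "q \<le> LENGTH('n)" "i \<in> {1..2 * LENGTH('n)}"
  shows "grave_theta q * grave_x i = grave_x i * (grave_theta q :: 'n::len0 grassmann)"
  unfolding grave_theta_def sum_distrib_left sum_distrib_right
  using assms by (intro sum.cong grave_pair_central) auto

lemma grave_theta_commute_pair:
  assumes "q \<le> LENGTH('n)" "j \<in> {1..LENGTH('n)}"
  shows "grave_theta q * grave_pair j = grave_pair j * (grave_theta q :: 'n::len0 grassmann)"
  unfolding grave_theta_def sum_distrib_left sum_distrib_right
  using assms by (intro sum.cong grave_pair_commute) auto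

text \<open>This is the binomial theorem with all terms of degree at least two in \<open>p\<close>
  gone. The exponent \<open>Suc s\<close> avoids a truncated \<open>s - 1\<close>.\<close>

lemma power_Suc_add_square_zero:
  fixes a p :: "'a::{real_algebra, monoid_mult}"
  assumes "a * p = p * a" "p * p = 0"
  shows "(a + p) ^ Suc s = a ^ Suc s + real (Suc s) *\<^sub>R (a ^ s * p)"
proof (induction s)
  case (Suc s)
  have square: "p * (a ^ s * p) = 0"
    unfolding power_commuting_commutes[OF assms(1)] by (simp add: assms(2) flip: mult.assoc)
  have commute: "p * a ^ Suc s = a ^ Suc s * p"
    by (rule power_commuting_commutes[OF assms(1), symmetric])
  show ?case
    unfolding power_Suc[of "a + p" "Suc s"] Suc distrib_left distrib_right mult_scaleR_right square commute
    by (simp add: mult.assoc scaleR_add_left scaleR_2)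
qed simp

text \<open>Both claims go through one induction that adds a pair at each step: nilpotency of the
  shorter sum removes the pure power from the binomial formula, which leaves \<open>Suc q\<close>
  times the old top power times the new pair.\<close>

lemma grave_theta_power:
  assumes "q \<le> LENGTH('n)"
  shows "grave_theta q ^ Suc q = (0 :: 'n::len0 grassmann)"
    and "grave_theta q ^ q = fact q *\<^sub>R (prod_list (map grave_x [1..<2 * q + 1]) :: 'n grassmann)"
proof -
  have "grave_theta q ^ Suc q = (0 :: 'n grassmann) \<and>
     grave_theta q ^ q = fact q *\<^sub>R (prod_list (map grave_x [1..<2 * q + 1]) :: 'n grassmann)"
    using assms
  proof (induction q)
    case 0
    then show ?case by (simp add: grave_theta_def)
  next
    case (Suc q)
    let ?a = "grave_theta q :: 'n grassmann" and ?p = "grave_pair (Suc q) :: 'n grassmann"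
    have q: "Suc q \<in> {1..LENGTH('n)}" "q \<le> LENGTH('n)"
      using Suc.prems by auto
    have theta: "grave_theta (Suc q) = ?a + ?p"
      by (simp add: grave_theta_def)
    note power = power_Suc_add_square_zero[OF grave_theta_commute_pair[OF q(2,1)] grave_pair_square[OF q(1)]]
    from Suc q have IH: "?a ^ Suc q = 0"
      "?a ^ q = fact q *\<^sub>R (prod_list (map grave_x [1..<2 * q + 1]) :: 'n grassmann)"
      by auto
    have "?a ^ Suc (Suc q) = 0"
      using IH(1) by (simp only: power_Suc[of _ "Suc q"] mult_zero_right)
    with IH(1) have "grave_theta (Suc q) ^ Suc (Suc q) = (0 :: 'n grassmann)"
      by (simp only: theta power mult_zero_left scaleR_zero_right add_0)
    moreover have "[1..<2 * Suc q + 1] = [1..<2 * q + 1] @ [2 * q + 1, 2 * q + 2]"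
      by simp
    then have "grave_theta (Suc q) ^ Suc q =
        fact (Suc q) *\<^sub>R (prod_list (map grave_x [1..<2 * Suc q + 1]) :: 'n grassmann)"
      unfolding theta power IH by (simp add: grave_pair_def mult.assoc del: upt_Suc)
    ultimately show ?case
      by blast
  qed
  then show "grave_theta q ^ Suc q = (0 :: 'n grassmann)"
    and "grave_theta q ^ q = fact q *\<^sub>R (prod_list (map grave_x [1..<2 * q + 1]) :: 'n grassmann)"
    by blast+
qed

section \<open>The fermionic Laplace operator on powers of theta\<close>

text \<open>Applying the Leibniz rule twice gives a minus sign when the derivative passes one
  generator, and a plus sign when it passes the whole pair.\<close>

lemma grassmann_deriv_grave_pair_mult:
  assumes "i \<in> {1..2 * LENGTH('n)}"
  shows "grassmann_deriv i (grave_pair j * (F :: 'n::len0 grassmann)) =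
    (if i = 2 * j - 1 then grave_x (2 * j) * F else 0)
    - (if i = 2 * j then grave_x (2 * j - 1) * F else 0) + grave_pair j * grassmann_deriv i F"
  unfolding grave_pair_def mult.assoc grassmann_deriv_grave_x_mult[OF assms]
  by (simp add: right_diff_distrib mult.assoc)

lemma grassmann_deriv_grave_theta_mult:
  assumes j: "j \<in> {1..LENGTH('n)}"
  shows "grassmann_deriv (2 * j) (grave_theta (LENGTH('n)) * (F :: 'n::len0 grassmann)) =
      grave_theta (LENGTH('n)) * grassmann_deriv (2 * j) F - grave_x (2 * j - 1) * F" (is ?even)
    and "grassmann_deriv (2 * j - 1) (grave_theta (LENGTH('n)) * (F :: 'n::len0 grassmann)) =
      grave_theta (LENGTH('n)) * grassmann_deriv (2 * j - 1) F + grave_x (2 * j) * F" (is ?odd)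
proof -
  have i: "2 * j - 1 \<in> {1..2 * LENGTH('n)}" "2 * j \<in> {1..2 * LENGTH('n)}"
    using j by auto
  have deriv: "grassmann_deriv i (grave_theta (LENGTH('n)) * F) =
      (\<Sum>l = 1..LENGTH('n). (if i = 2 * l - 1 then grave_x (2 * l) * F else 0)
        - (if i = 2 * l then grave_x (2 * l - 1) * F else 0) + grave_pair l * grassmann_deriv i F)"
    if "i \<in> {1..2 * LENGTH('n)}" for i
    unfolding grave_theta_def sum_distrib_right linear_sum[OF linear_grassmann_deriv]
    using that by (intro sum.cong grassmann_deriv_grave_pair_mult) auto
  \<comment> \<open>Parity excludes the first case, so only the pair \<open>l = j\<close> is hit, in
    its second factor; hence the minus sign.\<close>
  have even: "(\<Sum>l = 1..LENGTH('n). (if 2 * j = 2 * l - 1 then grave_x (2 * l) * F else 0)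
        - (if 2 * j = 2 * l then grave_x (2 * l - 1) * F else 0) + grave_pair l * grassmann_deriv (2 * j) F)
     = (\<Sum>l = 1..LENGTH('n). grave_pair l * grassmann_deriv (2 * j) F
        - (if j = l then grave_x (2 * l - 1) * F else 0))"
    by (intro sum.cong refl) (auto, presburger+)
  show ?even
    unfolding deriv[OF i(2)] even
    using j by (simp add: sum_subtractf grave_theta_def sum_distrib_right)
  \<comment> \<open>As \<open>j\<close> is at least 1, the subtraction is genuine and
    \<open>2 * j - 1\<close> is odd.\<close>
  have index: "2 * j - 1 = 2 * l - 1 \<longleftrightarrow> j = l" "2 * j - 1 \<noteq> 2 * l" if "l \<in> {1..LENGTH('n)}" for l
    using that j by (auto, presburger)
  have odd: "(\<Sum>l = 1..LENGTH('n). (if 2 * j - 1 = 2 * l - 1 then grave_x (2 * l) * F else 0)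
        - (if 2 * j - 1 = 2 * l then grave_x (2 * l - 1) * F else 0) + grave_pair l * grassmann_deriv (2 * j - 1) F)
     = (\<Sum>l = 1..LENGTH('n). grave_pair l * grassmann_deriv (2 * j - 1) F
        + (if j = l then grave_x (2 * l) * F else 0))"
    by (intro sum.cong refl) (simp add: index del: One_nat_def)
  show ?odd
    unfolding deriv[OF i(1)] odd
    using j by (simp add: sum.distrib grave_theta_def sum_distrib_right)
qed

lemma grassmann_deriv_grave_theta_power:
  assumes j: "j \<in> {1..LENGTH('n)}"
  shows "grassmann_deriv (2 * j) (grave_theta (LENGTH('n)) ^ s :: 'n::len0 grassmann) =
      - (real s *\<^sub>R (grave_x (2 * j - 1) * grave_theta (LENGTH('n)) ^ (s - 1)))" (is ?even)
    and "grassmann_deriv (2 * j - 1) (grave_theta (LENGTH('n)) ^ s :: 'n::len0 grassmann) =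
      real s *\<^sub>R (grave_x (2 * j) * grave_theta (LENGTH('n)) ^ (s - 1))" (is ?odd)
proof -
  let ?t = "grave_theta (LENGTH('n)) :: 'n grassmann"
  have i: "2 * j - 1 \<in> {1..2 * LENGTH('n)}" "2 * j \<in> {1..2 * LENGTH('n)}"
    using j by auto
  \<comment> \<open>Centrality of \<theta> moves the generator to the front. The factor
    \<open>real s\<close> makes the case \<open>s = 0\<close>, where \<open>s - 1\<close> is
    truncated, trivial.\<close>
  have shift: "real s *\<^sub>R (?t * (grave_x i * ?t ^ (s - 1))) = real s *\<^sub>R (grave_x i * ?t ^ s)"
    if "i \<in> {1..2 * LENGTH('n)}" for i s
    using grave_theta_central[OF order_refl that] by (cases s) (simp_all flip: mult.assoc)
  show ?even
  proof (induction s)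
    case (Suc s)
    then show ?case
      unfolding power_Suc grassmann_deriv_grave_theta_mult(1)[OF j]
      by (simp add: shift[OF i(1)] scaleR_add_left del: One_nat_def)
  qed (simp add: grassmann_deriv_one)
  show ?odd
  proof (induction s)
    case (Suc s)
    then show ?case
      unfolding power_Suc grassmann_deriv_grave_theta_mult(2)[OF j]
      by (simp add: shift[OF i(2)] scaleR_add_left del: One_nat_def)
  qed (simp add: grassmann_deriv_one)
qed

text \<open>With \<open>s = Suc r\<close>, each \<open>j\<close> contributes \<open>- s\<close>
  times \<open>\<theta> ^ r\<close> and \<open>s * r\<close> times its pair times
  \<open>\<theta> ^ (r - 1)\<close>. Over all \<open>j\<close>, the first terms add up
  \<open>LENGTH('n)\<close> times, and the pairs add up to \<theta> and restore
  \<open>\<theta> ^ r\<close>.\<close>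

lemma grassmann_laplace_grave_theta_power:
  "(\<Sum>j = 1..LENGTH('n). grassmann_deriv (2 * j - 1)
      (grassmann_deriv (2 * j) (grave_theta (LENGTH('n)) ^ s :: 'n::len0 grassmann))) =
    (real s * (real s - 1 - real LENGTH('n))) *\<^sub>R grave_theta (LENGTH('n)) ^ (s - 1)"
proof (cases s)
  case (Suc r)
  let ?t = "grave_theta (LENGTH('n)) :: 'n grassmann"
  have "grassmann_deriv (2 * j - 1) (grassmann_deriv (2 * j) (?t ^ s)) =
      - (real s *\<^sub>R ?t ^ r) + (real s * real r) *\<^sub>R (grave_pair j * ?t ^ (r - 1))"
    if j: "j \<in> {1..LENGTH('n)}" for j
  proof -
    have i: "2 * j - 1 \<in> {1..2 * LENGTH('n)}"
      using j by auto
    have "grassmann_deriv (2 * j - 1) (grassmann_deriv (2 * j) (?t ^ s)) =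
        - (real s *\<^sub>R (?t ^ r - grave_x (2 * j - 1) * (real r *\<^sub>R (grave_x (2 * j) * ?t ^ (r - 1)))))"
      unfolding grassmann_deriv_grave_theta_power(1)[OF j] linear_neg[OF linear_grassmann_deriv]
        linear_cmul[OF linear_grassmann_deriv] grassmann_deriv_grave_x_mult[OF i]
        grassmann_deriv_grave_theta_power(2)[OF j]
      by (simp add: Suc)
    then show ?thesis
      by (simp add: grave_pair_def mult.assoc scaleR_diff_right)
  qed
  then have "(\<Sum>j = 1..LENGTH('n). grassmann_deriv (2 * j - 1) (grassmann_deriv (2 * j) (?t ^ s))) =
      - ((real LENGTH('n) * real s) *\<^sub>R ?t ^ r) + (real s * real r) *\<^sub>R (?t * ?t ^ (r - 1))"
    by (simp add: sum.distrib sum_subtractf sum_constant_scaleR grave_theta_def[symmetric] del: One_nat_def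
        flip: scaleR_sum_right sum_distrib_right)
  \<comment> \<open>For \<open>r = 0\<close> the exponent \<open>r - 1\<close> is truncated, but the
    coefficient is 0.\<close>
  also have "(real s * real r) *\<^sub>R (?t * ?t ^ (r - 1)) = (real s * real r) *\<^sub>R ?t ^ r"
    by (cases r) simp_all
  finally show ?thesis
    by (simp add: Suc algebra_simps)
qed (simp add: grassmann_deriv_one linear_0[OF linear_grassmann_deriv])

section \<open>The square of the fermionic vector variable\<close>

lemma sum_odd_even:
  "(\<Sum>i = 1..2 * n. f i) = (\<Sum>j = 1..n. f (2 * j - 1) + f (2 * j))"
  for f :: "nat \<Rightarrow> 'a::comm_monoid_add"
  by (induction n) (simp_all add: add.assoc)

lemma clifford_grave_e_commutator:
  assumes "i \<in> {1..LENGTH('n)}" "j \<in> {1..LENGTH('n)}"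
  shows "clifford_grave_e (2 * i) * clifford_grave_e (2 * j) -
      clifford_grave_e (2 * j) * clifford_grave_e (2 * i) = (0 :: ('m, 'n::len0) clifford)"
    and "clifford_grave_e (2 * i - 1) * clifford_grave_e (2 * j - 1) -
      clifford_grave_e (2 * j - 1) * clifford_grave_e (2 * i - 1) = (0 :: ('m, 'n) clifford)"
    and "clifford_grave_e (2 * i - 1) * clifford_grave_e (2 * j) -
      clifford_grave_e (2 * j) * clifford_grave_e (2 * i - 1) = (if i = j then 1 else 0 :: ('m, 'n) clifford)"
proof -
  show "clifford_grave_e (2 * i) * clifford_grave_e (2 * j) -
      clifford_grave_e (2 * j) * clifford_grave_e (2 * i) = (0 :: ('m, 'n::len0) clifford)"
    using assms by transfer (unfold diff_0_right, rule ideal_of_generator, unfold clifford_rels_def, blast)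
  show "clifford_grave_e (2 * i - 1) * clifford_grave_e (2 * j - 1) -
      clifford_grave_e (2 * j - 1) * clifford_grave_e (2 * i - 1) = (0 :: ('m, 'n) clifford)"
    using assms by transfer (unfold diff_0_right, rule ideal_of_generator, unfold clifford_rels_def, blast)
  show "clifford_grave_e (2 * i - 1) * clifford_grave_e (2 * j) -
      clifford_grave_e (2 * j) * clifford_grave_e (2 * i - 1) = (if i = j then 1 else 0 :: ('m, 'n) clifford)"
    using assms by transfer (rule ideal_of_generator, unfold clifford_rels_def, blast)
qed

lemmas tensor_sum =
  linear_sum[OF bilinear_tensor[unfolded bilinear_def, THEN conjunct1, rule_format]]
  linear_sum[OF bilinear_tensor[unfolded bilinear_def, THEN conjunct2, rule_format]]

lemma tensor_minus_zero:
  "(- a) \<otimes> b = - (a \<otimes> b)" "a \<otimes> (- b) = - (a \<otimes> b)" "a \<otimes> (b - c) = a \<otimes> b - a \<otimes> c"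
  "0 \<otimes> b = 0" "a \<otimes> 0 = 0"
  by (rule bilinear_lneg[OF bilinear_tensor] bilinear_rneg[OF bilinear_tensor] bilinear_rsub[OF bilinear_tensor]
    bilinear_lzero[OF bilinear_tensor] bilinear_rzero[OF bilinear_tensor])+

text \<open>The Grassmann products are antisymmetric in the two indices, so twice the square is a
  double sum of Grassmann products tensored with commutators \<open>c i j\<close>. Only the
  commutators of the two generators with indices \<open>2 * i - 1\<close> and \<open>2 * i\<close>
  survive.\<close>

lemma grave_vector_square:
  "grave_vector * (grave_vector :: ('m, 'n::len0) super_algebra) = grave_theta (LENGTH('n)) \<otimes> 1"
proof -
  let ?N = "LENGTH('n)"
  let ?x = "grave_x :: nat \<Rightarrow> 'n grassmann" and ?e = "clifford_grave_e :: nat \<Rightarrow> ('m, 'n) clifford"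
  define c where "c i j = (?x i * ?x j) \<otimes> (?e i * ?e j - ?e j * ?e i)" for i j
  have square: "grave_vector * (grave_vector :: ('m, 'n) super_algebra) =
      (\<Sum>i = 1..2 * ?N. \<Sum>j = 1..2 * ?N. (?x i * ?x j) \<otimes> (?e i * ?e j))"
    unfolding grave_vector_def sum_product tensor_mult_tensor ..
  also have "\<dots> = (\<Sum>i = 1..2 * ?N. \<Sum>j = 1..2 * ?N. (?x j * ?x i) \<otimes> (?e j * ?e i))"
    by (rule sum.swap)
  also have "\<dots> = (\<Sum>i = 1..2 * ?N. \<Sum>j = 1..2 * ?N. - ((?x i * ?x j) \<otimes> (?e j * ?e i)))"
    by (intro sum.cong refl) (metis grave_x_anticommute tensor_minus_zero(1))
  finally have "(2::real) *\<^sub>R (grave_vector * (grave_vector :: ('m, 'n) super_algebra)) =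
      (\<Sum>i = 1..2 * ?N. \<Sum>j = 1..2 * ?N. c i j)"
    unfolding scaleR_2 by (subst (1) square) (simp add: c_def tensor_minus_zero(3) sum_subtractf sum_negf)
  also have "\<dots> = (\<Sum>i = 1..?N. (2::real) *\<^sub>R (grave_pair i \<otimes> 1))"
    unfolding sum_odd_even
  proof (rule sum.cong[OF refl])
    fix i assume i: "i \<in> {1..?N}"
    have c: "c (2 * i) (2 * j) = 0" "c (2 * i - 1) (2 * j - 1) = 0"
      "c (2 * i - 1) (2 * j) = (if j = i then grave_pair i \<otimes> 1 else 0)"
      "c (2 * i) (2 * j - 1) = (if j = i then grave_pair i \<otimes> 1 else 0)" if j: "j \<in> {1..?N}" for j
    proof -
      show "c (2 * i) (2 * j) = 0" "c (2 * i - 1) (2 * j - 1) = 0"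
        "c (2 * i - 1) (2 * j) = (if j = i then grave_pair i \<otimes> 1 else 0)"
        unfolding c_def clifford_grave_e_commutator[OF i j] by (auto simp: tensor_minus_zero grave_pair_def)
      have ij: "2 * i \<in> {1..2 * ?N}" "2 * j - 1 \<in> {1..2 * ?N}"
        using i j by auto
      \<comment> \<open>The reversed commutator changes sign, and so does the reversed Grassmann
        product; each pair is therefore counted twice, which matches the factor 2.\<close>
      have "?e (2 * i) * ?e (2 * j - 1) - ?e (2 * j - 1) * ?e (2 * i) = - (if j = i then 1 else 0)"
        unfolding clifford_grave_e_commutator(3)[OF j i, symmetric] by simp
      then show "c (2 * i) (2 * j - 1) = (if j = i then grave_pair i \<otimes> 1 else 0)"
        unfolding c_def grave_x_anticommute[OF ij] by (auto simp: tensor_minus_zero grave_pair_def)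
    qed
    have "(\<Sum>j = 1..?N. c (2 * i - 1) (2 * j - 1) + c (2 * i - 1) (2 * j)) =
        (\<Sum>j = 1..?N. if j = i then grave_pair i \<otimes> 1 else 0)"
      "(\<Sum>j = 1..?N. c (2 * i) (2 * j - 1) + c (2 * i) (2 * j)) =
        (\<Sum>j = 1..?N. if j = i then grave_pair i \<otimes> 1 else 0)"
      by (intro sum.cong refl; simp only: c add_0_left add_0_right)+
    then show "(\<Sum>j = 1..?N. c (2 * i - 1) (2 * j - 1) + c (2 * i - 1) (2 * j)) +
        (\<Sum>j = 1..?N. c (2 * i) (2 * j - 1) + c (2 * i) (2 * j)) = (2::real) *\<^sub>R (grave_pair i \<otimes> 1)"
      using i by (simp only: sum.delta' sum.delta finite_atLeastAtMost if_True scaleR_2)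
  qed
  also have "\<dots> = (2::real) *\<^sub>R (grave_theta ?N \<otimes> 1)"
    unfolding grave_theta_def tensor_sum scaleR_sum_right ..
  finally show ?thesis
    by simp
qed

lemma grave_vector_even_power:
  "(grave_vector :: ('m, 'n::len0) super_algebra) ^ (2 * s) = grave_theta (LENGTH('n)) ^ s \<otimes> 1"
  unfolding power_mult power2_eq_square grave_vector_square
  by (induction s) (simp_all add: one_tensor_def tensor_mult_tensor)

section \<open>The super Laplace operator\<close>

lemma linear_super_laplace: "linear super_laplace"
proof -
  note lin = linear_add[OF linear_tensor_map] linear_cmul[OF linear_tensor_map]
  show ?thesis
    by (rule linearI)
      (simp_all add: super_laplace_def super_laplace_b_def super_laplace_f_def super_partial_def
        super_grave_partial_def lin sum.distrib scaleR_add_right scaleR_diff_right scaleR_sum_right mult.commute)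
qed

lemma super_laplace_tensor:
  "super_laplace (T \<otimes> F \<otimes> a :: ('m::finite, 'n::len0) super_distribution) =
    laplace_b T \<otimes> F \<otimes> a +
    4 *\<^sub>R (T \<otimes> (\<Sum>j = 1..LENGTH('n). grassmann_deriv (2 * j - 1) (grassmann_deriv (2 * j) F)) \<otimes> a)"
  unfolding super_laplace_def super_laplace_b_def super_laplace_f_def super_partial_def
    super_grave_partial_def laplace_b_def
  by (simp add: tensor_map_tensor linear_distribution_partial linear_id linear_tensor_map
      linear_grassmann_deriv tensor_minus_zero tensor_sum)

lemma super_laplace_tensor_theta:
  "super_laplace (T \<otimes> grave_theta (LENGTH('n)) ^ s \<otimes> 1 :: ('m::finite, 'n::len0) super_distribution) =
    laplace_b T \<otimes> grave_theta (LENGTH('n)) ^ s \<otimes> 1 +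
    (4 * (real s * (real s - 1 - real LENGTH('n)))) *\<^sub>R (T \<otimes> grave_theta (LENGTH('n)) ^ (s - 1) \<otimes> 1)"
  unfolding super_laplace_tensor grassmann_laplace_grave_theta_power tensor_linear scaleR_scaleR ..

section \<open>The rising-factorial sums and the recursion in \<open>k\<close>\<close>

definition super_fundamental ::
    "(nat \<Rightarrow> 'm::finite distribution) \<Rightarrow> nat \<Rightarrow> ('m, 'n::len0) super_distribution" where
  "super_fundamental M k = (\<Sum>l\<le>LENGTH('n). (4 ^ l * pochhammer (real k) l / fact (LENGTH('n) - l)) *\<^sub>R
     (M (l + k) \<otimes> grave_theta (LENGTH('n)) ^ (LENGTH('n) - l) \<otimes> 1))"

text \<open>The bosonic part of term \<open>Suc l\<close> and the fermionic part of term
  \<open>l\<close> are multiples of the same tensor, so the sums can be compared coefficient by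
  coefficient.\<close>

lemma super_laplace_super_fundamental:
  assumes M: "\<And>j. laplace_b (M (Suc j)) = M j"
  shows "super_laplace (super_fundamental M (Suc k) :: ('m::finite, 'n::len0) super_distribution) =
    super_fundamental M k"
proof -
  let ?N = "LENGTH('n)"
  define a where "a k l = 4 ^ l * pochhammer (real k) l / fact (?N - l)" for k l
  define t :: "nat \<Rightarrow> nat \<Rightarrow> ('m, 'n) super_distribution" where
    "t j s = M j \<otimes> grave_theta ?N ^ s \<otimes> 1" for j s
  have lap: "super_laplace (t (Suc j) s) =
      t j s + (4 * (real s * (real s - 1 - real ?N))) *\<^sub>R t (Suc j) (s - 1)" for j s
    unfolding t_def super_laplace_tensor_theta M ..
  \<comment> \<open>With the common factor
    \<open>4 ^ Suc l * pochhammer (real (Suc k)) l / fact (?N - Suc l)\<close> taken out, this reads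
    \<open>(k + 1 + l) - (l + 1) = k\<close>; the factor \<open>k\<close> then extends the rising
    factorial downwards.\<close>
  have coeff: "a (Suc k) (Suc l) + a (Suc k) l * (4 * (real (?N - l) * (real (?N - l) - 1 - real ?N))) = a k (Suc l)"
    if "l < ?N" for l
  proof -
    have diff: "real (?N - l) = real ?N - real l"
      using that by simp
    have "?N - l = Suc (?N - Suc l)"
      using that by simp
    with diff have fact: "(real ?N - real l) / fact (?N - l) = 1 / fact (?N - Suc l)"
      by (simp add: field_simps)
    have poch: "pochhammer (real (Suc k)) (Suc l) = pochhammer (real (Suc k)) l * (real k + 1 + real l)"
      "pochhammer (real k) (Suc l) = real k * pochhammer (real (Suc k)) l"
      by (simp add: pochhammer_Suc, simp add: pochhammer_rec add.commute)
    have "a (Suc k) l * (4 * (real (?N - l) * (real (?N - l) - 1 - real ?N))) =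
        4 ^ Suc l * pochhammer (real (Suc k)) l * ((real ?N - real l) / fact (?N - l)) * (- (real l + 1))"
      unfolding a_def diff by (simp add: field_simps)
    then have "a (Suc k) (Suc l) + a (Suc k) l * (4 * (real (?N - l) * (real (?N - l) - 1 - real ?N))) =
        4 ^ Suc l * (pochhammer (real (Suc k)) l * (real k + 1 + real l)) / fact (?N - Suc l)
        + 4 ^ Suc l * pochhammer (real (Suc k)) l * (1 / fact (?N - Suc l)) * (- (real l + 1))"
      by (simp only: fact a_def poch)
    also have "\<dots> = 4 ^ Suc l * (real k * pochhammer (real (Suc k)) l) / fact (?N - Suc l)"
      by (simp add: field_simps)
    also have "\<dots> = a k (Suc l)"
      by (simp only: a_def poch)
    finally show ?thesis .
  qed
  have "super_laplace (super_fundamental M (Suc k) :: ('m, 'n) super_distribution) =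
      (\<Sum>l\<le>?N. a (Suc k) l *\<^sub>R super_laplace (t (Suc (l + k)) (?N - l)))"
    unfolding super_fundamental_def a_def t_def
    by (simp add: linear_sum[OF linear_super_laplace] linear_cmul[OF linear_super_laplace])
  also have "\<dots> = (\<Sum>l\<le>?N. a (Suc k) l *\<^sub>R t (l + k) (?N - l)) +
      (\<Sum>l\<le>?N. (a (Suc k) l * (4 * (real (?N - l) * (real (?N - l) - 1 - real ?N)))) *\<^sub>R
         t (Suc l + k) (?N - Suc l))"
    unfolding lap scaleR_add_right sum.distrib by simp
  \<comment> \<open>The leading coefficient \<open>a k 0\<close> does not depend on
    \<open>k\<close>.\<close>
  also have "(\<Sum>l\<le>?N. a (Suc k) l *\<^sub>R t (l + k) (?N - l)) =
      a k 0 *\<^sub>R t (0 + k) (?N - 0) + (\<Sum>l<?N. a (Suc k) (Suc l) *\<^sub>R t (Suc l + k) (?N - Suc l))"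
    unfolding sum.atMost_shift by (simp add: a_def)
  \<comment> \<open>The term \<open>l = ?N\<close> has coefficient 0, since a constant in the
    Grassmann variables is killed by the derivatives.\<close>
  also have "(\<Sum>l\<le>?N. (a (Suc k) l * (4 * (real (?N - l) * (real (?N - l) - 1 - real ?N)))) *\<^sub>R
         t (Suc l + k) (?N - Suc l)) =
      (\<Sum>l<?N. (a (Suc k) l * (4 * (real (?N - l) * (real (?N - l) - 1 - real ?N)))) *\<^sub>R
         t (Suc l + k) (?N - Suc l))"
    by (simp flip: lessThan_Suc_atMost)
  also have "a k 0 *\<^sub>R t (0 + k) (?N - 0) + (\<Sum>l<?N. a (Suc k) (Suc l) *\<^sub>R t (Suc l + k) (?N - Suc l)) + \<dots> =
      a k 0 *\<^sub>R t (0 + k) (?N - 0) + (\<Sum>l<?N. a k (Suc l) *\<^sub>R t (Suc l + k) (?N - Suc l))"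
    unfolding add.assoc sum.distrib[symmetric] scaleR_add_left[symmetric]
    by (intro arg_cong2[of _ _ _ _ "(+)"] refl sum.cong) (simp only: coeff lessThan_iff)
  also have "\<dots> = super_fundamental M k"
    unfolding super_fundamental_def a_def t_def sum.atMost_shift ..
  finally show ?thesis .
qed

text \<open>The rising factorial of 0 vanishes for positive \<open>l\<close>, and the remaining
  power of \<theta>, divided by the factorial, is the product of all generators.\<close>

lemma super_fundamental_0:
  "super_fundamental M 0 = (M 0 \<otimes> prod_list (map grave_x [1..<2 * LENGTH('n) + 1]) \<otimes> 1
     :: ('m::finite, 'n::len0) super_distribution)"
proof -
  have "super_fundamental M 0 = ((1 / fact (LENGTH('n))) *\<^sub>R
      (M 0 \<otimes> grave_theta (LENGTH('n)) ^ LENGTH('n) \<otimes> 1) :: ('m, 'n) super_distribution)"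
    unfolding super_fundamental_def sum.atMost_shift by (simp add: pochhammer_0_left)
  then show ?thesis
    by (simp add: grave_theta_power(2) tensor_linear del: upt_Suc)
qed

lemma super_laplace_power_super_fundamental:
  assumes "\<And>j. laplace_b (M (Suc j)) = M j"
  shows "(super_laplace ^^ k) (super_fundamental M k) = super_fundamental M 0"
  by (induction k) (simp_all add: funpow_swap1 super_laplace_super_fundamental[where M = M, OF assms])

section \<open>Identification of the stated sum with a rising-factorial sum\<close>

theorem theorem4:
  fixes n k :: nat
    and \<nu> :: "nat \<Rightarrow> 'm::finite distribution"
  assumes n: "n = LENGTH('n::len0)"
    and k: "k \<ge> 1"
    and \<nu>_step: "\<And>l j. l \<ge> 1 \<Longrightarrow> j < l \<Longrightarrow> (laplace_b ^^ j) (\<nu> (2 * l)) = \<nu> (2 * l - 2 * j)"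
    and \<nu>_fundamental: "\<And>l. l \<ge> 1 \<Longrightarrow> (laplace_b ^^ l) (\<nu> (2 * l)) = dirac"
  shows "(super_laplace ^^ k)
      (\<Sum>l = 0..n. (4 ^ l * fact (l + k - 1) / (fact (n - l) * fact (k - 1))) *\<^sub>R
        (\<nu> (2 * l + 2 * k) \<otimes> (grave_vector :: ('m, 'n) super_algebra) ^ (2 * n - 2 * l)))
    = super_dirac"
proof -
  \<comment> \<open>Halving the index and putting \<open>dirac\<close> at place 0 merges both
    hypotheses into one rule: \<open>j = 0\<close> comes from fundamentality of
    \<open>\<nu> 2\<close>, and every other \<open>j\<close> from a single descent step.\<close>
  define M where "M j = (if j = 0 then dirac else \<nu> (2 * j))" for j
  have M: "laplace_b (M (Suc j)) = M j" for j
    using \<nu>_step[of "Suc j" 1] \<nu>_fundamental[of 1] by (cases "j = 0") (simp_all add: M_def flip: numeral_2_eq_2)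
  \<comment> \<open>Here \<open>k \<ge> 1\<close> makes \<open>k - 1\<close> a true predecessor
    \<open>q\<close>; the identity splits the rising factorial of 1 of length \<open>q + l\<close>
    after \<open>q\<close> factors.\<close>
  have coeff: "fact (l + k - 1) / fact (k - 1) = pochhammer (real k) l" for l
  proof -
    from k obtain q where q: "k = Suc q"
      by (cases k) auto
    have "fact (q + l) = fact q * pochhammer (real (Suc q)) l"
      using pochhammer_product'[of "1::real" q l] by (simp add: pochhammer_fact add.commute)
    then show ?thesis
      by (simp add: q add.commute)
  qed
  have "(\<Sum>l = 0..n. (4 ^ l * fact (l + k - 1) / (fact (n - l) * fact (k - 1))) *\<^sub>R
        (\<nu> (2 * l + 2 * k) \<otimes> (grave_vector :: ('m, 'n) super_algebra) ^ (2 * n - 2 * l)))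
      = super_fundamental M k"
    unfolding super_fundamental_def atMost_atLeast0 n
  proof (intro sum.cong refl arg_cong2[of _ _ _ _ scaleR] arg_cong2[of _ _ _ _ tensor])
    fix l
    show "4 ^ l * fact (l + k - 1) / (fact (LENGTH('n) - l) * fact (k - 1)) =
        4 ^ l * pochhammer (real k) l / fact (LENGTH('n) - l)"
      by (simp flip: coeff)
    show "\<nu> (2 * l + 2 * k) = M (l + k)"
      using k by (simp add: M_def algebra_simps)
    show "(grave_vector :: ('m, 'n) super_algebra) ^ (2 * LENGTH('n) - 2 * l) =
        grave_theta (LENGTH('n)) ^ (LENGTH('n) - l) \<otimes> 1"
      unfolding right_diff_distrib'[symmetric] by (rule grave_vector_even_power)
  qed
  then show ?thesis
    using M by (simp add: super_laplace_power_super_fundamental super_fundamental_0 super_dirac_def M_def)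
qed

end
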